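(* Let $a_n=|\operatorname{Av}_n(\underline{12}\square 3)|$ for $n\ge 0$. Then $a_n=n!$ for $0\le n\le 3$, and for $n\ge 4$ $$a_n=a_{n-1}+(n-1)a_{n-2}+\frac{(n+1)(n-2)}{2}a_{n-3}+\sum_{i=4}^{n-1}\left(\binom{n}{i-1}-1\right)a_{n-i}+(n-1).$$
   Context: $\operatorname{Av}_n(\underline{12}\square 3)$ is the set of permutations $\pi=\pi_1\cdots\pi_n$ of $[n]$ having no occurrence of the pattern $\underline{12}\square 3$, where an occurrence is a triple of entries $\pi_i,\pi_{i+1},\pi_k$ with $k\ge i+3$ and $\pi_i<\pi_{i+1}<\pi_k$ (the first two letters are adjacent, and at least one other letter lies between the second and third). An empty sum is $0$. *)

theory Defs
  imports Complex_Main "HOL-Combinatorics.Multiset_Permutations"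
begin

text \<open>
  A permutation of \<open>{1..n}\<close> is its one-line word, an element of \<open>permutations_of_set {1..n}\<close>.
  List positions are counted from \<open>0\<close>; the positional conditions of the pattern only involve
  differences of positions, so they are unaffected by this shift.
\<close>

definition occurs_at_12_box_3 :: "nat list \<Rightarrow> nat \<Rightarrow> nat \<Rightarrow> bool" where
  "occurs_at_12_box_3 p i k \<longleftrightarrow>
     i + 3 \<le> k \<and> k < length p \<and> p ! i < p ! (i + 1) \<and> p ! (i + 1) < p ! k"

definition Av_12_box_3 :: "nat \<Rightarrow> nat list set" where
  "Av_12_box_3 n = {p \<in> permutations_of_set {1..n}. \<not> (\<exists>i k. occurs_at_12_box_3 p i k)}"

end

theory Submission
  imports Defs
begin

text \<open>
  Split an avoider of length \<open>n\<close> at its greatest letter, as \<open>u @ n # v\<close>. The letter \<open>n\<close> forbids every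
  ascent of \<open>u\<close> except one at its very end, and such a final ascent to \<open>p\<close> is harmless exactly when
  all letters of \<open>v\<close> are below \<open>p\<close>; otherwise \<open>v\<close> is an arbitrary avoider. If \<open>u\<close> has length
  \<open>m \<ge> 1\<close>, there are \<open>n - 1 choose m\<close> decreasing \<open>u\<close>. In the other case \<open>u\<close> is determined by its
  first \<open>m - 1\<close> letters, and only one set of them fails, which gives \<open>(n - 1 choose (m - 1)) - 1\<close>.
  Together these are \<open>(n choose m) - 1\<close> prefixes.
\<close>

section \<open>Avoidance by recursion on the word\<close>

fun avoids :: "nat list \<Rightarrow> bool" where
  "avoids (x # y # zs) \<longleftrightarrow> avoids (y # zs) \<and> (x < y \<longrightarrow> (\<forall>z\<in>set (tl zs). z \<le> y))"
| "avoids _ \<longleftrightarrow> True"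

lemma occurs_at_Cons_Suc:
  "occurs_at_12_box_3 (x # p) (Suc i) (Suc k) \<longleftrightarrow> occurs_at_12_box_3 p i k"
  by (auto simp: occurs_at_12_box_3_def)

lemma ex_occurs_at_0:
  "(\<exists>k. occurs_at_12_box_3 (x # y # zs) 0 k) \<longleftrightarrow> x < y \<and> (\<exists>z\<in>set (tl zs). y < z)"
proof
  assume "\<exists>k. occurs_at_12_box_3 (x # y # zs) 0 k"
  then obtain k where k: "3 \<le> k" "k < length zs + 2" "x < y" "y < (x # y # zs) ! k"
    by (auto simp: occurs_at_12_box_3_def)
  \<comment> \<open>Position \<open>k\<close> of the whole word is position \<open>k - 3\<close> of
    \<open>tl zs\<close>, the word left after \<open>x\<close>, \<open>y\<close> and the letter
    under the box.\<close>
  obtain j where j: "k = Suc (Suc (Suc j))"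
    using k(1) by (metis add_numeral_left le_Suc_ex numeral_3_eq_3 plus_nat.simps(2) add_0)
  show "x < y \<and> (\<exists>z\<in>set (tl zs). y < z)"
    using k j by (cases zs) (auto intro!: bexI[of _ "tl zs ! j"])
next
  assume *: "x < y \<and> (\<exists>z\<in>set (tl zs). y < z)"
  then obtain j where "j < length (tl zs)" "y < tl zs ! j"
    by (auto simp: in_set_conv_nth)
  with * show "\<exists>k. occurs_at_12_box_3 (x # y # zs) 0 k"
    by (cases zs) (auto simp: occurs_at_12_box_3_def intro!: exI[of _ "j + 3"])
qed

text \<open>An occurrence either starts at the first letter, where passing to \<open>tl\<close>
  accounts for the box, or is an occurrence in the tail shifted by one place.\<close>

lemma avoids_iff: "avoids p \<longleftrightarrow> \<not> (\<exists>i k. occurs_at_12_box_3 p i k)"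
proof (induction p rule: avoids.induct)
  case (1 x y zs)
  have "(\<exists>i k. occurs_at_12_box_3 (x # y # zs) i k) \<longleftrightarrow>
     (\<exists>k. occurs_at_12_box_3 (x # y # zs) 0 k) \<or> (\<exists>i k. occurs_at_12_box_3 (y # zs) i k)"
    (is "?L \<longleftrightarrow> ?R")
  proof
    assume ?L
    then obtain i k where ik: "occurs_at_12_box_3 (x # y # zs) i k" by blast
    have "k \<noteq> 0" using ik by (auto simp: occurs_at_12_box_3_def)
    with ik show ?R
      by (cases i; cases k) (auto simp: occurs_at_Cons_Suc)
  next
    assume ?R
    then show ?L using occurs_at_Cons_Suc by blast
  qed
  with 1 show ?case by (auto simp: ex_occurs_at_0 not_less)
qed (auto simp: occurs_at_12_box_3_def)

lemma avoids_map:
  assumes "strict_mono_on A f" "set p \<subseteq> A"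
  shows "avoids (map f p) \<longleftrightarrow> avoids p"
  using assms(2)
proof (induction p rule: avoids.induct)
  case (1 x y zs)
  have "z \<in> A" if "z \<in> set (tl zs)" for z
    using that 1(2) by (cases zs) auto
  with 1 assms(1) show ?case
    by (auto simp: strict_mono_on_less strict_mono_on_less_eq simp flip: map_tl)
qed auto

section \<open>Avoiders over arbitrary finite sets of letters\<close>

definition avoiders :: "nat set \<Rightarrow> nat list set" where
  "avoiders A = {p \<in> permutations_of_set A. avoids p}"

lemma Av_12_box_3_eq_avoiders: "Av_12_box_3 n = avoiders {1..n}"
  by (auto simp: Av_12_box_3_def avoiders_def avoids_iff)

lemma finite_avoiders: "finite (avoiders A)"
  by (simp add: avoiders_def)

text \<open>Avoidance depends only on the relative order of the letters, so the increasing bijection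
  from \<open>{1..card A}\<close> to \<open>A\<close> carries avoiders to avoiders.\<close>

lemma card_avoiders:
  assumes "finite A"
  shows "card (avoiders A) = card (Av_12_box_3 (card A))"
proof -
  let ?I = "{1..card A}"
  \<comment> \<open>The increasing enumeration of \<open>A\<close>; letters start at 1 but list
    positions at 0, hence \<open>i - 1\<close>.\<close>
  define f where "f i = sorted_list_of_set A ! (i - 1)" for i
  have mono: "strict_mono_on ?I f"
    unfolding f_def strict_mono_on_def
    using strict_sorted_list_of_set[of A] assms by (auto simp: sorted_wrt_nth_less)
  then have inj: "inj_on f ?I" by (rule strict_mono_on_imp_inj_on)
  have "f ` ?I = set (sorted_list_of_set A)"
  proof
    show "f ` ?I \<subseteq> set (sorted_list_of_set A)"
      unfolding f_def using assms by (auto simp del: set_sorted_list_of_set intro!: nth_mem)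
    show "set (sorted_list_of_set A) \<subseteq> f ` ?I"
    proof
      fix x assume "x \<in> set (sorted_list_of_set A)"
      then obtain i where "i < card A" "x = sorted_list_of_set A ! i"
        by (auto simp del: set_sorted_list_of_set simp: in_set_conv_nth)
      then show "x \<in> f ` ?I" by (intro image_eqI[of _ _ "Suc i"]) (auto simp: f_def)
    qed
  qed
  then have img: "f ` ?I = A" using assms by simp
  have "permutations_of_set A = map f ` permutations_of_set ?I"
    using permutations_of_set_image_inj[OF inj] by (simp only: img)
  moreover have "avoids (map f p) \<longleftrightarrow> avoids p" if "p \<in> permutations_of_set ?I" for p
    using that avoids_map[OF mono, of p] by (auto dest: permutations_of_setD)
  ultimately have "avoiders A = map f ` avoiders ?I"
    by (auto simp: avoiders_def)
  moreover have "inj_on (map f) (avoiders ?I)"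
    by (rule inj_on_mapI, rule inj_on_subset[OF inj])
      (auto simp: avoiders_def permutations_of_set_def)
  ultimately show ?thesis
    by (simp add: card_image Av_12_box_3_eq_avoiders)
qed

section \<open>Decomposition at the greatest letter\<close>

definition ascent_prefix :: "nat set \<Rightarrow> nat list \<Rightarrow> bool" where
  "ascent_prefix A u \<longleftrightarrow> (\<exists>d p. u = d @ [p] \<and> d \<noteq> [] \<and> sorted_wrt (>) d \<and>
     last d < p \<and> (\<forall>y\<in>A - set u. y < p))"

text \<open>Deleting \<open>a\<close> from both word and alphabet leaves the set of letters outside
  the word unchanged. With three letters present, the decreasing part stays nonempty after the
  deletion.\<close>

lemma ascent_prefix_Cons3:
  "ascent_prefix A (a # b # c # u) \<longleftrightarrow> b < a \<and> ascent_prefix (A - {a}) (b # c # u)"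
proof
  assume "ascent_prefix A (a # b # c # u)"
  then obtain d p where d: "a # b # c # u = d @ [p]" "sorted_wrt (>) d" "last d < p"
    "\<forall>y\<in>A - set (a # b # c # u). y < p"
    unfolding ascent_prefix_def by blast
  obtain d' where d': "d = a # b # d'"
    using d(1) by (cases d; cases "tl d") auto
  with d show "b < a \<and> ascent_prefix (A - {a}) (b # c # u)"
    unfolding ascent_prefix_def by (auto intro!: exI[of _ "b # d'"])
next
  assume r: "b < a \<and> ascent_prefix (A - {a}) (b # c # u)"
  then obtain d p where d: "b # c # u = d @ [p]" "sorted_wrt (>) d" "last d < p" "d \<noteq> []"
    "\<forall>y\<in>A - {a} - set (b # c # u). y < p"
    unfolding ascent_prefix_def by blast
  obtain d' where d': "d = b # d'"
    using d(1,4) by (cases d) auto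
  with d r show "ascent_prefix A (a # b # c # u)"
    unfolding ascent_prefix_def by (auto intro!: exI[of _ "a # d"])
qed

lemma ascent_prefix_short [simp]:
  "\<not> ascent_prefix A []" "\<not> ascent_prefix A [a]"
  by (auto simp: ascent_prefix_def Cons_eq_append_conv)

lemma ascent_prefix_pair:
  "ascent_prefix A [a, b] \<longleftrightarrow> a < b \<and> (\<forall>y\<in>A - {a, b}. y < b)"
  by (auto simp: ascent_prefix_def Cons_eq_append_conv)

lemma avoids_Cons_greatest:
  "\<forall>y\<in>set v. y < x \<Longrightarrow> avoids (x # v) \<longleftrightarrow> avoids v"
  by (cases v) auto

text \<open>Induction on \<open>u\<close>. If at least one letter of \<open>u\<close> follows
  \<open>a\<close> and \<open>b\<close>, then \<open>x\<close> lies beyond the box and would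
  complete an ascent from \<open>a\<close> to \<open>b\<close>, so \<open>b < a\<close> is forced.
  If \<open>u\<close> is \<open>[a, b]\<close>, then \<open>x\<close> itself lies under the box, and
  an ascent constrains only \<open>v\<close>. An ascent to \<open>x\<close> is always
  harmless.\<close>

lemma avoids_append_greatest:
  assumes "distinct (u @ x # v)" "\<forall>y\<in>set u \<union> set v. y < x"
  shows "avoids (u @ x # v) \<longleftrightarrow>
    avoids v \<and> (sorted_wrt (>) u \<or> ascent_prefix (set (u @ v)) u)"
  using assms
proof (induction u rule: induct_list012)
  case 1
  then show ?case by (simp add: avoids_Cons_greatest)
next
  case (2 a)
  then show ?case by (cases v) (auto simp: avoids_Cons_greatest less_imp_le)
next
  case (3 a b u)
  show ?case
  proof (cases u)
    case Nil
    have "\<forall>z\<in>set (tl v). z \<le> x"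
      using 3(4) by (cases v) (auto intro: less_imp_le)
    moreover have "avoids (x # v) \<longleftrightarrow> avoids v"
      using 3(4) by (simp add: avoids_Cons_greatest)
    \<comment> \<open>\<open>avoids\<close> compares weakly and \<open>ascent_prefix\<close>
      strictly; distinctness of the letters reconciles the two.\<close>
    moreover have "(\<forall>z\<in>set v. z \<le> b) \<longleftrightarrow> (\<forall>z\<in>set v. z < b)"
      using 3(3) by (metis UnI2 distinct.simps(2) distinct_append append_Cons le_neq_implies_less
          less_imp_le list.set_intros(2) set_append)
    moreover have "set ([a, b] @ v) - {a, b} = set v" "a \<noteq> b"
      using 3(3) Nil by auto
    ultimately show ?thesis
      unfolding Nil ascent_prefix_pair by (simp, linarith)
  next
    case (Cons c w)
    have "set ((a # b # u) @ v) - {a} = set ((b # u) @ v)"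
      using 3(3) by auto
    then have "ascent_prefix (set ((a # b # u) @ v)) (a # b # u) \<longleftrightarrow>
        b < a \<and> ascent_prefix (set ((b # u) @ v)) (b # u)"
      unfolding Cons ascent_prefix_Cons3 by simp
    moreover have "avoids ((a # b # u) @ x # v) \<longleftrightarrow> b < a \<and> avoids ((b # u) @ x # v)"
      using 3(3,4) Cons by auto
    moreover have "sorted_wrt (>) (a # b # u) \<longleftrightarrow> b < a \<and> sorted_wrt (>) (b # u)"
      by auto
    moreover have "avoids ((b # u) @ x # v) \<longleftrightarrow>
      avoids v \<and> (sorted_wrt (>) (b # u) \<or> ascent_prefix (set ((b # u) @ v)) (b # u))"
      using 3 by auto
    ultimately show ?thesis by blast
  qed
qed

definition prefixes :: "nat set \<Rightarrow> nat list set" where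
  "prefixes B = {u. distinct u \<and> set u \<subseteq> B \<and> (sorted_wrt (>) u \<or> ascent_prefix B u)}"

lemma finite_prefixes: "finite B \<Longrightarrow> finite (prefixes B)"
  by (rule finite_subset[OF _ finite_subset_distinct[of B]]) (auto simp: prefixes_def)

lemma avoiders_insert_greatest:
  assumes "\<forall>y\<in>B. y < x"
  shows "avoiders (insert x B) = (\<lambda>(u, v). u @ x # v) ` (SIGMA u:prefixes B. avoiders (B - set u))"
proof (intro equalityI subsetI)
  fix p assume "p \<in> avoiders (insert x B)"
  then have p: "distinct p" "set p = insert x B" "avoids p"
    by (auto simp: avoiders_def permutations_of_set_def)
  then obtain u v where uv: "p = u @ x # v"
    by (metis in_set_conv_decomp insertI1)
  have xB: "x \<notin> B" using assms by blast
  have B: "set (u @ v) = B" using p uv xB by auto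
  then have vB: "set v = B - set u" using p(1) uv by auto
  have "avoids v \<and> (sorted_wrt (>) u \<or> ascent_prefix (set (u @ v)) u)"
    using avoids_append_greatest[of u x v] p uv assms B by auto
  then have "u \<in> prefixes B" "v \<in> avoiders (B - set u)"
    using p uv B vB unfolding B by (auto simp: prefixes_def avoiders_def permutations_of_set_def)
  with uv show "p \<in> (\<lambda>(u, v). u @ x # v) ` (SIGMA u:prefixes B. avoiders (B - set u))"
    by (intro image_eqI[of _ _ "(u, v)"]) auto
next
  fix p assume "p \<in> (\<lambda>(u, v). u @ x # v) ` (SIGMA u:prefixes B. avoiders (B - set u))"
  then obtain u v where uv: "p = u @ x # v" "u \<in> prefixes B" "v \<in> avoiders (B - set u)"
    by auto
  have v: "set v = B - set u" "distinct v" "avoids v"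
    using uv(3) by (auto simp: avoiders_def permutations_of_set_def)
  have u: "set u \<subseteq> B" "distinct u" "sorted_wrt (>) u \<or> ascent_prefix B u"
    using uv(2) by (auto simp: prefixes_def)
  have B: "set (u @ v) = B" and d: "distinct (u @ x # v)"
    using u v assms by auto
  have "avoids p"
    using avoids_append_greatest[OF d] assms u v B uv(1) by auto
  then show "p \<in> avoiders (insert x B)"
    using d B uv(1) by (auto simp: avoiders_def permutations_of_set_def)
qed

text \<open>The position of \<open>x\<close> recovers \<open>u\<close> and \<open>v\<close>, so the
  decomposition is unique. By relabelling, the number of choices for \<open>v\<close> depends only
  on the length of \<open>u\<close>, which allows grouping by that length.\<close>

lemma card_avoiders_insert_greatest:
  assumes "finite B" "\<forall>y\<in>B. y < x"
  shows "card (avoiders (insert x B)) =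
    (\<Sum>m\<le>card B. card {u \<in> prefixes B. length u = m} * card (Av_12_box_3 (card B - m)))"
proof -
  have "inj_on (\<lambda>(u, v). u @ x # v) (SIGMA u:prefixes B. avoiders (B - set u))"
  proof (rule inj_onI, clarify)
    fix u v u' v'
    assume *: "u \<in> prefixes B" "u' \<in> prefixes B" "v \<in> avoiders (B - set u)"
      "v' \<in> avoiders (B - set u')" and eq: "u @ x # v = u' @ x # v'"
    then have "x \<notin> set u" "x \<notin> set v" "x \<notin> set u'"
      using assms(2) by (auto simp: prefixes_def avoiders_def permutations_of_set_def)
    then show "u = u' \<and> v = v'"
      using eq append_Cons_eq_iff[of x u v u' v'] by auto
  qed
  then have "card (avoiders (insert x B)) = (\<Sum>u\<in>prefixes B. card (avoiders (B - set u)))"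
    by (simp add: avoiders_insert_greatest[OF assms(2)] card_image finite_prefixes[OF assms(1)]
        finite_avoiders)
  also have "\<dots> = (\<Sum>u\<in>prefixes B. card (Av_12_box_3 (card B - length u)))"
  proof (rule sum.cong[OF refl])
    fix u assume "u \<in> prefixes B"
    then have "card (B - set u) = card B - length u"
      by (subst card_Diff_subset) (auto simp: prefixes_def distinct_card)
    then show "card (avoiders (B - set u)) = card (Av_12_box_3 (card B - length u))"
      using card_avoiders[of "B - set u"] assms(1) by simp
  qed
  also have "\<dots> = (\<Sum>m\<le>card B. \<Sum>u\<in>{u \<in> prefixes B. length u = m}.
      card (Av_12_box_3 (card B - length u)))"
  proof (rule sum.group[symmetric])
    show "length ` prefixes B \<subseteq> {..card B}"
      using assms(1) by (auto simp: prefixes_def card_mono simp flip: distinct_card)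
  qed (use assms(1) finite_prefixes in auto)
  finally show ?thesis by simp
qed

section \<open>Counting the prefixes of each length\<close>

definition decr_list :: "nat set \<Rightarrow> nat list" where
  "decr_list D = rev (sorted_list_of_set D)"

lemma decr_list:
  assumes "finite D"
  shows "set (decr_list D) = D" "length (decr_list D) = card D" "distinct (decr_list D)"
    "sorted_wrt (>) (decr_list D)"
  using assms by (auto simp: decr_list_def sorted_wrt_rev)

lemma decr_list_unique:
  assumes "sorted_wrt (>) (d :: nat list)"
  shows "d = decr_list (set d)"
proof -
  have "sorted_wrt (<) (rev d)" using assms by (simp add: sorted_wrt_rev)
  then have "sorted_list_of_set (set (rev d)) = rev d"
    by (simp add: strict_sorted_iff sorted_list_of_set.idem_if_sorted_distinct del: set_rev)
  then show ?thesis by (simp add: decr_list_def)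
qed

text \<open>A decreasing word is determined by its set of letters, so this counts the
  \<open>m\<close>-element subsets of \<open>B\<close>.\<close>

lemma card_decreasing:
  fixes B :: "nat set"
  assumes "finite B"
  shows "card {u. set u \<subseteq> B \<and> sorted_wrt (>) u \<and> length u = m} = card B choose m"
proof -
  have "{u. set u \<subseteq> B \<and> sorted_wrt (>) u \<and> length u = m} =
      decr_list ` {D. D \<subseteq> B \<and> card D = m}" (is "?L = _ ` ?R")
  proof (intro equalityI subsetI)
    fix u assume u: "u \<in> ?L"
    have "u = decr_list (set u)" using u decr_list_unique by auto
    moreover have "card (set u) = m"
      using calculation decr_list(2)[of "set u"] u by simp
    ultimately show "u \<in> decr_list ` ?R" using u by blast
  next
    fix u assume "u \<in> decr_list ` ?R"
    then show "u \<in> ?L" using assms by (auto simp: decr_list finite_subset)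
  qed
  moreover have "inj_on decr_list ?R"
    by (rule inj_onI) (metis (mono_tags) assms decr_list(1) finite_subset mem_Collect_eq)
  ultimately show ?thesis
    using n_subsets[OF assms] by (simp add: card_image)
qed

text \<open>In an ascending prefix the last letter is forced to be the greatest letter outside the
  decreasing part, and the only choice of the decreasing part for which this letter does not
  create an ascent is the set of the largest letters.\<close>

lemma ascent_prefixes_eq:
  "{u. distinct u \<and> set u \<subseteq> {1..N} \<and> ascent_prefix {1..N} u \<and> length u = Suc k} =
    (\<lambda>D. decr_list D @ [Max ({1..N} - D)]) `
      {D. D \<subseteq> {1..N} \<and> card D = k \<and> \<not> (\<forall>d\<in>D. \<forall>y\<in>{1..N} - D. y < d)}"
  (is "?L = ?g ` ?R")
proof (intro equalityI subsetI)
  fix u assume u: "u \<in> ?L"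
  then obtain d p where d: "u = d @ [p]" "d \<noteq> []" "sorted_wrt (>) d" "last d < p"
    "\<forall>y\<in>{1..N} - set u. y < p"
    by (auto simp: ascent_prefix_def)
  have "p \<in> {1..N} - set d" using u d by auto
  moreover have "y \<le> p" if "y \<in> {1..N} - set d" for y
    using that d by (cases "y = p") (auto intro: less_imp_le)
  ultimately have "Max ({1..N} - set d) = p"
    by (intro Max_eqI) auto
  moreover have "d = decr_list (set d)" using d decr_list_unique by auto
  moreover have "set d \<in> ?R"
  proof -
    \<comment> \<open>The final ascent itself shows that \<open>set d\<close> does not consist of
      the largest letters: \<open>last d\<close> belongs to it, while the greater letter
      \<open>p\<close> does not.\<close>
    have "last d \<in> set d" "\<not> p < last d" using d by auto
    then have "\<not> (\<forall>d'\<in>set d. \<forall>y\<in>{1..N} - set d. y < d')"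
      using \<open>p \<in> {1..N} - set d\<close> by blast
    then show ?thesis using u d(1) by (simp add: distinct_card)
  qed
  ultimately show "u \<in> ?g ` ?R"
    using d(1) by (intro image_eqI[of _ _ "set d"]) simp_all
next
  fix u assume "u \<in> ?g ` ?R"
  then obtain D d y where D: "u = ?g D" "D \<subseteq> {1..N}" "card D = k"
    and dy: "d \<in> D" "y \<in> {1..N} - D" "\<not> y < d" by auto
  have fD: "finite D" using D(2) finite_subset[OF _ finite_atLeastAtMost] by blast
  let ?p = "Max ({1..N} - D)"
  have p: "?p \<in> {1..N} - D" using dy by (intro Max_in) auto
  have le: "z \<le> ?p" if "z \<in> {1..N} - D" for z using that by auto
  have ne: "decr_list D \<noteq> []" using dy decr_list(1)[OF fD] by auto
  \<comment> \<open>The last letter of the decreasing word is the least element of \<open>D\<close>.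
    Together with \<open>d < ?p\<close>, this makes the step to \<open>?p\<close> an ascent.\<close>
  have "last (decr_list D) \<le> d"
  proof -
    obtain h t where "sorted_list_of_set D = h # t"
      using ne by (cases "sorted_list_of_set D") (auto simp: decr_list_def)
    then show ?thesis
      using dy(1) fD sorted_sorted_list_of_set[of D] set_sorted_list_of_set[OF fD]
      by (auto simp: decr_list_def simp del: sorted_list_of_set.sorted_sorted_key_list_of_set)
  qed
  moreover have "d < ?p" using le[OF dy(2)] dy p by (metis DiffD2 le_neq_implies_less le_trans not_less)
  ultimately have "ascent_prefix {1..N} u"
    unfolding ascent_prefix_def D(1) using ne decr_list[OF fD] le
    by (intro exI[of _ "decr_list D"] exI[of _ ?p]) (auto simp: le_neq_implies_less)
  then show "u \<in> ?L" using D p decr_list[OF fD] by auto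
qed

text \<open>Such a \<open>D\<close> is comparable under inclusion with the interval of the
  \<open>k\<close> largest letters: otherwise some element of \<open>D\<close> would lie below a
  missing letter of the interval. Equal cardinalities then give equality.\<close>

lemma top_subset_unique:
  assumes "k \<le> N"
  shows "{D. D \<subseteq> {1..N} \<and> card D = k \<and> (\<forall>d\<in>D. \<forall>y\<in>{1..N} - D. y < d)} = {{N - k<..N}}"
proof (intro equalityI subsetI)
  fix D assume "D \<in> {D. D \<subseteq> {1..N} \<and> card D = k \<and> (\<forall>d\<in>D. \<forall>y\<in>{1..N} - D. y < d)}"
  then have D: "D \<subseteq> {1..N}" "card D = k" "\<forall>d\<in>D. \<forall>y\<in>{1..N} - D. y < d" by auto
  have fD: "finite D" using D(1) finite_subset[OF _ finite_atLeastAtMost] by blast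
  have "D \<subseteq> {N - k<..N} \<or> {N - k<..N} \<subseteq> D"
  proof (rule ccontr)
    assume "\<not> ?thesis"
    then obtain x y where "x \<in> D" "x \<notin> {N - k<..N}" "y \<in> {N - k<..N}" "y \<notin> D" by blast
    then have "x \<in> {1..N}" "y \<in> {1..N} - D" "x \<le> y" using D(1) by auto
    with D(3) \<open>x \<in> D\<close> show False by (meson leD)
  qed
  moreover have "card {N - k<..N} = k" using assms by simp
  ultimately show "D \<in> {{N - k<..N}}"
    using D(2) fD by (metis card_subset_eq finite_greaterThanAtMost singleton_iff)
qed (use assms in auto)

text \<open>The \<open>k\<close> letters before the last form any \<open>k\<close>-subset except the
  top one, and dropping the last letter recovers this subset. For \<open>k = 0\<close> the empty set
  is the excluded subset, matching the absence of an ascent in a single letter.\<close>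

lemma card_ascent_prefixes:
  assumes "k < N"
  shows "card {u. distinct u \<and> set u \<subseteq> {1..N} \<and> ascent_prefix {1..N} u \<and> length u = Suc k} =
    (N choose k) - 1"
proof -
  let ?S = "{D. D \<subseteq> {1..N} \<and> card D = k}"
  let ?T = "{D. D \<subseteq> {1..N} \<and> card D = k \<and> (\<forall>d\<in>D. \<forall>y\<in>{1..N} - D. y < d)}"
  let ?R = "{D. D \<subseteq> {1..N} \<and> card D = k \<and> \<not> (\<forall>d\<in>D. \<forall>y\<in>{1..N} - D. y < d)}"
  have "inj_on (\<lambda>D. decr_list D @ [Max ({1..N} - D)]) ?R"
    by (rule inj_onI)
      (metis (mono_tags, lifting) append1_eq_conv decr_list(1) finite_atLeastAtMost finite_subset
        mem_Collect_eq)
  moreover have "?R = ?S - ?T" by auto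
  moreover have "card (?S - ?T) = card ?S - card ?T"
    by (intro card_Diff_subset) (auto simp: top_subset_unique assms less_imp_le)
  moreover have "card ?S = N choose k" using n_subsets[of "{1..N}" k] by simp
  moreover have "card ?T = 1" using top_subset_unique[of k N] assms by simp
  ultimately show ?thesis unfolding ascent_prefixes_eq by (simp add: card_image)
qed

text \<open>A final ascent rules out a decreasing word, so the two kinds of prefix are counted
  separately and added. The empty prefix is a case of its own, since the binomial formula would give
  0 there.\<close>

lemma card_prefixes:
  assumes "m \<le> N"
  shows "card {u \<in> prefixes {1..N}. length u = m} = (if m = 0 then 1 else (Suc N choose m) - 1)"
proof (cases m)
  case 0
  have "{u \<in> prefixes {1..N}. length u = 0} = {[]}" by (auto simp: prefixes_def)
  with 0 show ?thesis by simp
next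
  case (Suc k)
  let ?X = "{u. set u \<subseteq> {1..N} \<and> sorted_wrt (>) u \<and> length u = m}"
  let ?Y = "{u. distinct u \<and> set u \<subseteq> {1..N} \<and> ascent_prefix {1..N} u \<and> length u = m}"
  have dist: "distinct u" if "sorted_wrt (>) u" for u :: "nat list"
    using that decr_list_unique[OF that] decr_list(3)[of "set u"] by simp
  have fin: "finite ?X" "finite ?Y"
    by (rule finite_subset[OF _ finite_subset_distinct[of "{1..N}"]]; use dist in auto)+
  have "?X \<inter> ?Y = {}"
    by (auto simp: ascent_prefix_def sorted_wrt_append) (metis last_in_set not_less_iff_gr_or_eq)
  moreover have "{u \<in> prefixes {1..N}. length u = m} = ?X \<union> ?Y"
    using dist by (auto simp: prefixes_def)
  ultimately have "card {u \<in> prefixes {1..N}. length u = m} = card ?X + card ?Y"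
    using fin by (simp add: card_Un_disjoint)
  also have "card ?X = N choose m" using card_decreasing[of "{1..N}" m] by simp
  also have "card ?Y = (N choose k) - 1" using card_ascent_prefixes[of k N] assms Suc by simp
  \<comment> \<open>Pascal's rule; \<open>k < N\<close> makes \<open>N choose k\<close> positive, so
    the truncated subtraction is exact.\<close>
  also have "(N choose m) + ((N choose k) - 1) = (Suc N choose m) - 1"
    using Suc assms zero_less_binomial[of k N] by (simp del: zero_less_binomial_iff)
  finally show ?thesis using Suc by simp
qed

section \<open>The recurrence\<close>

lemma card_Av_rec:
  assumes "n \<ge> 1"
  shows "card (Av_12_box_3 n) = card (Av_12_box_3 (n - 1)) +
    (\<Sum>i = 2..n. ((n choose (i - 1)) - 1) * card (Av_12_box_3 (n - i)))"
proof -
  obtain N where n: "n = Suc N" using assms by (cases n) auto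
  have "insert (Suc N) {1..N} = {1..Suc N}" by auto
  then have "card (Av_12_box_3 n) = (\<Sum>m\<le>N. card {u \<in> prefixes {1..N}. length u = m}
      * card (Av_12_box_3 (N - m)))"
    using card_avoiders_insert_greatest[of "{1..N}" "Suc N"] n
    by (simp add: Av_12_box_3_eq_avoiders)
  also have "\<dots> = (\<Sum>m\<le>N. (if m = 0 then 1 else (Suc N choose m) - 1) * card (Av_12_box_3 (N - m)))"
    by (intro sum.cong refl) (simp only: card_prefixes atMost_iff)
  also have "\<dots> = card (Av_12_box_3 N) +
      (\<Sum>m = 1..N. ((Suc N choose m) - 1) * card (Av_12_box_3 (N - m)))"
    by (simp add: atMost_atLeast0 sum.atLeast_Suc_atMost)
  \<comment> \<open>Substituting \<open>i = m + 1\<close>: the greatest letter stands in place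
    \<open>i\<close>, with \<open>i - 1\<close> letters before it and \<open>Suc N - i\<close> after
    it.\<close>
  also have "(\<Sum>m = 1..N. ((Suc N choose m) - 1) * card (Av_12_box_3 (N - m))) =
      (\<Sum>i = 2..Suc N. ((Suc N choose (i - 1)) - 1) * card (Av_12_box_3 (Suc N - i)))"
    using sum.shift_bounds_cl_Suc_ivl[of "\<lambda>i. ((Suc N choose (i - 1)) - 1) * card (Av_12_box_3 (Suc N - i))" 1 N]
    by (simp add: numeral_2_eq_2)
  finally show ?thesis using n by simp
qed

lemma card_Av_0: "card (Av_12_box_3 0) = 1"
  by (simp add: Av_12_box_3_eq_avoiders avoiders_def Collect_conv_if)

theorem theorem5p1:
  fixes a :: "nat \<Rightarrow> nat"
  assumes a_def: "\<And>n. a n = card (Av_12_box_3 n)"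
  shows "(\<forall>n\<le>3. a n = fact n) \<and>
    (\<forall>n\<ge>4. real (a n) =
        real (a (n - 1)) + (real n - 1) * real (a (n - 2))
        + (real n + 1) * (real n - 2) / 2 * real (a (n - 3))
        + (\<Sum>i = 4..n - 1. (real (n choose (i - 1)) - 1) * real (a (n - i)))
        + (real n - 1))"
proof -
  have rec: "a n = a (n - 1) + (\<Sum>i = 2..n. ((n choose (i - 1)) - 1) * a (n - i))" if "n \<ge> 1" for n
    using card_Av_rec[OF that] by (simp add: a_def)
  have a0: "a 0 = 1" by (simp add: a_def card_Av_0)
  have a1: "a 1 = 1" using rec[of 1] a0 by simp
  have a2: "a 2 = 2" using rec[of 2] a0 a1 by simp
  have "{2..3} = {2, 3::nat}" by auto
  then have a3: "a 3 = 6" using rec[of 3] a0 a1 a2 by (simp add: choose_two)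
  have small: "a n = fact n" if "n \<le> 3" for n
  proof -
    have "n = 0 \<or> n = 1 \<or> n = 2 \<or> n = 3" using that by auto
    then show ?thesis using a0 a1 a2 a3 by (auto simp: fact_numeral)
  qed
  have large: "real (a n) =
        real (a (n - 1)) + (real n - 1) * real (a (n - 2))
        + (real n + 1) * (real n - 2) / 2 * real (a (n - 3))
        + (\<Sum>i = 4..n - 1. (real (n choose (i - 1)) - 1) * real (a (n - i)))
        + (real n - 1)" if n: "n \<ge> 4" for n
  proof -
    define g where "g i = (real (n choose (i - 1)) - 1) * real (a (n - i))" for i
    \<comment> \<open>The binomial coefficient is at least 1, so subtraction on naturals agrees with
      subtraction on reals.\<close>
    have "real (((n choose (i - 1)) - 1) * a (n - i)) = g i" if "i \<in> {2..n}" for i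
    proof -
      have "i - 1 \<le> n" using that by auto
      then have "1 \<le> n choose (i - 1)" by (simp add: Suc_le_eq)
      then show ?thesis by (simp add: g_def of_nat_diff)
    qed
    then have "real (\<Sum>i = 2..n. ((n choose (i - 1)) - 1) * a (n - i)) = (\<Sum>i = 2..n. g i)"
      unfolding of_nat_sum by (intro sum.cong refl) auto
    \<comment> \<open>The terms 2, 3 and \<open>n\<close> are the ones displayed separately in the
      formula; for \<open>n = 4\<close> the remaining range is empty.\<close>
    also have "\<dots> = sum g ({2, 3, n} \<union> {4..n - 1})"
      using n by (intro arg_cong[of _ _ "sum g"]) auto
    also have "\<dots> = g 2 + g 3 + g n + (\<Sum>i = 4..n - 1. g i)"
      using n by (subst sum.union_disjoint) auto
    finally have "real (a n) = real (a (n - 1)) + (g 2 + g 3 + g n + (\<Sum>i = 4..n - 1. g i))"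
      using rec[of n] n by (simp only: of_nat_add)
    moreover have "g 2 = (real n - 1) * real (a (n - 2))" by (simp add: g_def)
    moreover have "real (n choose 2) = real n * (real n - 1) / 2"
      using n by (simp add: choose_two real_of_nat_div of_nat_diff)
    then have "real (n choose 2) - 1 = (real n + 1) * (real n - 2) / 2"
      by (simp add: field_simps)
    then have "g 3 = (real n + 1) * (real n - 2) / 2 * real (a (n - 3))"
      by (simp add: g_def)
    \<comment> \<open>By symmetry the coefficient is \<open>n choose 1\<close> less 1, and the
      factor \<open>a 0\<close> is 1.\<close>
    moreover have "g n = real n - 1"
      using n a0 binomial_symmetric[of 1 n] by (simp add: g_def)
    ultimately show ?thesis by (simp add: g_def)
  qed
  show ?thesis using small large by blast
qed

end
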